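(* For nonnegative integers $n,k$ let $s(n,k)$ be the number of natural tests with cost $n$ and exactly $k$ distinct valid answers, and let $\mathcal{S}_k(x)=\sum_{n\ge 0}s(n,k)x^n$. Then, as formal power series, $$\mathcal{S}_k(x)=\prod_{j=1}^{\infty}\left(\frac{1}{1-x^j}-x^{j^2}\right)\sum_{1\le i_1<\cdots<i_k}\ \prod_{r=1}^{k}\frac{x^{i_r^2}(1-x^{i_r})}{1-x^{i_r^2}+x^{i_r^2+i_r}},$$ where the sum is over all strictly increasing $k$-tuples of positive integers (for $k=0$ the sum equals $1$).
   Context: A natural test is a finite multiset of positive integers (its answers; order is irrelevant). The empty test is allowed and has cost $0$. The cost of a test is the sum of all its answers with multiplicity, so a natural test of cost $n$ is a partition of $n$. A positive integer $a$ is a valid answer of a natural test if $a$ appears in the test exactly $a$ times. *)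

theory Defs
  imports "HOL-Analysis.Analysis" "HOL-Computational_Algebra.Formal_Power_Series"
begin

definition natural_test :: "nat multiset \<Rightarrow> bool"
  where "natural_test T \<longleftrightarrow> (\<forall>a \<in># T. a > 0)"

definition cost :: "nat multiset \<Rightarrow> nat"
  where "cost T = sum_mset T"

(* Positivity is essential: in a test not containing 0, the number 0 occurs exactly 0 times. *)
definition valid_answer :: "nat multiset \<Rightarrow> nat \<Rightarrow> bool"
  where "valid_answer T a \<longleftrightarrow> a > 0 \<and> count T a = a"

definition num_tests :: "nat \<Rightarrow> nat \<Rightarrow> nat"
  where "num_tests n k =
    card {T. natural_test T \<and> cost T = n \<and> card {a. valid_answer T a} = k}"

(* Rational coefficients, because reciprocals of fps need a coefficient type with inverse. *)
definition tests_gf :: "nat \<Rightarrow> rat fps"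
  where "tests_gf k = Abs_fps (\<lambda>n. of_nat (num_tests n k))"

(* Lists are indexed from 0, so the r-th component i_r of a tuple (r = 1..k) is is ! (r - 1). *)
definition increasing_tuples :: "nat \<Rightarrow> nat list set"
  where "increasing_tuples k =
    {is. length is = k \<and> sorted_wrt (<) is \<and> (\<forall>i \<in> set is. i \<ge> 1)}"

end

theory Submission
  imports Defs
begin

text \<open>
  A test of cost \<open>n\<close> has all its answers in \<open>{1..n}\<close>, and it is determined by the multiplicities of
  \<open>1, \<dots>, n\<close>, which can be chosen independently. Prescribing the set \<open>A\<close> of valid answers means:
  \<open>j\<close> occurs exactly \<open>j\<close> times for \<open>j \<in> A\<close>, which contributes a factor \<open>x\<^bsup>j\<^sup>2\<^esup>\<close> to the generating
  function, and any other number of times for \<open>j \<notin> A\<close>, which contributes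
  \<open>F\<^sub>j = 1 / (1 - x\<^sup>j) - x\<^bsup>j\<^sup>2\<^esup>\<close> (\<open>card_restricted_partitions\<close>). Since
  \<open>F\<^sub>j (1 - x\<^sup>j) = 1 - x\<^bsup>j\<^sup>2\<^esup> + x\<^bsup>j\<^sup>2 + j\<^esup>\<close>, turning an invalid \<open>j\<close> into a valid one amounts to
  multiplying by the fraction of the claimed formula (\<open>invalid_gf_mult_valid_ratio\<close>). Hence the
  generating function for the set \<open>A\<close> is the product of all \<open>F\<^sub>j\<close> times the product of these
  fractions over \<open>A\<close>, and summing over the sets \<open>A\<close> of size \<open>k\<close> gives the formula.

  This argument only ever involves finitely many parts, so it gives the coefficient of \<open>x\<^sup>n\<close> with
  \<open>F\<^sub>j\<close> and \<open>A\<close> restricted to \<open>{1..n}\<close> (\<open>num_tests_eq_nth\<close>). The passage to the infinite product and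
  sum is harmless because the remaining factors are congruent to 1 and the remaining summands
  congruent to 0 modulo \<open>x\<^bsup>n+1\<^esup>\<close> (\<open>fps_convergent_prod\<close>, \<open>infsum_increasing_tuples\<close>).
\<close>

unbundle no vec_syntax
unbundle fps_syntax

section \<open>Formal power series known up to a given degree\<close>

lemma fps_nth_eq_0_if_X_power_dvd:
  fixes f :: "'a::comm_ring_1 fps"
  assumes "fps_X ^ m dvd f" "n < m"
  shows "f $ n = 0"
  using assms by (auto elim!: dvdE simp: fps_X_power_mult_nth)

lemma fps_mult_nth_cong:
  fixes f g f' g' :: "'a::semiring_0 fps"
  assumes "\<And>i. i \<le> n \<Longrightarrow> f $ i = f' $ i" "\<And>i. i \<le> n \<Longrightarrow> g $ i = g' $ i"
  shows "(f * g) $ n = (f' * g') $ n"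
  unfolding fps_mult_nth by (intro sum.cong) (auto simp: assms)

text \<open>
  Multiplying by a factor that is 1 modulo \<open>x\<^bsup>j+1\<^esup>\<close> leaves the coefficients up to degree \<open>j\<close> alone.
  The index starts at 0, so \<open>F j\<close> is the factor that belongs to the part \<open>j + 1\<close>.
\<close>

lemma fps_prod_nth_stable:
  fixes F :: "nat \<Rightarrow> 'a::comm_ring_1 fps"
  assumes F: "\<And>j. fps_X ^ Suc j dvd F j - 1" and "i \<le> m" "m \<le> n"
  shows "(\<Prod>j<n. F j) $ i = (\<Prod>j<m. F j) $ i"
  using \<open>m \<le> n\<close>
proof (induction n rule: dec_induct)
  case (step n)
  have "(\<Prod>j<Suc n. F j) = (\<Prod>j<n. F j) + (\<Prod>j<n. F j) * (F n - 1)"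
    by (simp add: algebra_simps)
  moreover have "((\<Prod>j<n. F j) * (F n - 1)) $ i = 0"
    using \<open>i \<le> m\<close> step.hyps
    by (intro fps_nth_eq_0_if_X_power_dvd[of "Suc n"] dvd_mult F) auto
  ultimately show ?case
    using step.IH by simp
qed auto

text \<open>
  The coefficients of the partial products stabilise, which is convergence in the topology on
  formal power series. The limit is nonzero, as \<open>convergent_prod\<close> demands, since its constant
  coefficient is that of the empty product.
\<close>

lemma fps_convergent_prod:
  fixes F :: "nat \<Rightarrow> 'a::idom fps"
  assumes F: "\<And>j. fps_X ^ Suc j dvd F j - 1"
  shows "convergent_prod F"
    and "i \<le> n \<Longrightarrow> (\<Prod>j. F j) $ i = (\<Prod>j<n. F j) $ i"
proof -
  define L where "L = Abs_fps (\<lambda>i. (\<Prod>j<i. F j) $ i)"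
  have L: "L $ i = (\<Prod>j<n. F j) $ i" if "i \<le> n" for i n
    using fps_prod_nth_stable[OF F order_refl that] by (simp add: L_def)
  have "L $ 0 = 1"
    by (simp add: L_def)
  moreover have "(\<lambda>n. \<Prod>j\<le>n. F j) \<longlonglongrightarrow> L"
  proof (rule tendsto_fpsI)
    fix i
    have "(\<Prod>j\<le>n. F j) $ i = L $ i" if "n \<ge> i" for n
      using L[of i "Suc n"] that by (simp add: lessThan_Suc_atMost)
    thus "\<forall>\<^sub>F n in sequentially. (\<Prod>j\<le>n. F j) $ i = L $ i"
      by (auto simp: eventually_sequentially)
  qed
  ultimately have *: "raw_has_prod F 0 L"
    by (auto simp: raw_has_prod_def)
  thus "convergent_prod F"
    by (auto simp: convergent_prod_def)
  have "prodinf F = L"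
    using * by (metis has_prod_def has_prod_unique)
  thus "i \<le> n \<Longrightarrow> (\<Prod>j. F j) $ i = (\<Prod>j<n. F j) $ i"
    using L by simp
qed

section \<open>Sums over increasing tuples\<close>

text \<open>A strictly increasing tuple is the sorted enumeration of the set of its entries.\<close>

lemma bij_betw_set_increasing_tuples:
  "bij_betw set (increasing_tuples k) {A. finite A \<and> 0 \<notin> A \<and> card A = k}"
proof (rule bij_betw_byWitness[where f' = sorted_list_of_set])
  show "\<forall>is\<in>increasing_tuples k. sorted_list_of_set (set is) = is"
    by (auto simp: increasing_tuples_def strict_sorted_iff
             intro: sorted_list_of_set.idem_if_sorted_distinct)
  show "set ` increasing_tuples k \<subseteq> {A. finite A \<and> 0 \<notin> A \<and> card A = k}"
    by (auto simp: increasing_tuples_def strict_sorted_iff distinct_card)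
  show "sorted_list_of_set ` {A. finite A \<and> 0 \<notin> A \<and> card A = k} \<subseteq> increasing_tuples k"
    by (auto simp: increasing_tuples_def Suc_le_eq intro: gr0I)
qed auto

lemma prod_increasing_tuple:
  fixes h :: "nat \<Rightarrow> 'a::comm_monoid_mult"
  assumes "is \<in> increasing_tuples k"
  shows "(\<Prod>r<k. h (is ! r)) = (\<Prod>j\<in>set is. h j)"
proof -
  have "bij_betw ((!) is) {..<k} (set is)"
    using assms by (intro bij_betw_nth) (auto simp: increasing_tuples_def strict_sorted_iff)
  thus ?thesis
    by (rule prod.reindex_bij_betw)
qed

text \<open>
  A set with an element above \<open>i\<close> contributes a product divisible by \<open>x\<^bsup>i+1\<^esup>\<close>. So only the finitely
  many subsets of \<open>{1..i}\<close> matter for the coefficient of \<open>x\<^sup>i\<close>. The second claim allows a common bound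
  \<open>n\<close> for all \<open>i \<le> n\<close>, which is what multiplication with another series requires.
\<close>

lemma infsum_increasing_tuples:
  fixes h :: "nat \<Rightarrow> 'a::comm_ring_1 fps" and k :: nat
  assumes h: "\<And>j. fps_X ^ j dvd h j"
  defines "G \<equiv> (\<lambda>is. \<Prod>r<k. h (is ! r))"
  shows "G summable_on increasing_tuples k"
    and "i \<le> n \<Longrightarrow> (\<Sum>\<^sub>\<infinity>is\<in>increasing_tuples k. G is) $ i
           = (\<Sum>A | A \<subseteq> {1..n} \<and> card A = k. \<Prod>j\<in>A. h j) $ i"
proof -
  define K :: "nat set set" where "K = {A. finite A \<and> 0 \<notin> A \<and> card A = k}"
  define K' where "K' n = {A. A \<subseteq> {1..n} \<and> card A = k}" for n :: nat
  define P where "P A = (\<Prod>j\<in>A. h j)" for A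
  define L where "L = Abs_fps (\<lambda>n. \<Sum>A\<in>K' n. P A $ n)"
  have fin: "finite (K' n)" for n
    by (rule finite_subset[of _ "Pow {1..n}"]) (auto simp: K'_def)
  have P0: "P A $ i = 0" if "A \<in> K" "A \<notin> K' i" for A i
  proof -
    have "\<not> A \<subseteq> {1..i}"
      using that by (auto simp: K_def K'_def)
    then obtain j where j: "j \<in> A" "j \<notin> {1..i}"
      by blast
    with that have "j > i"
      by (cases j) (auto simp: K_def)
    moreover have "fps_X ^ j dvd P A"
      using that j unfolding P_def K_def by (intro dvd_trans[OF h[of j]] dvd_prodI) auto
    ultimately show ?thesis
      by (intro fps_nth_eq_0_if_X_power_dvd)
  qed
  have K'K: "K' n \<subseteq> K" for n
    by (auto simp: K_def K'_def intro: finite_subset)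
  have "(P has_sum L) K"
  proof (rule has_sum_fpsI)
    fix n
    have sub: "{A \<in> K. P A $ n \<noteq> 0} \<subseteq> K' n"
      using P0 by blast
    show "finite {A \<in> K. P A $ n \<noteq> 0}"
      using sub fin by (rule finite_subset)
    show "L $ n = (\<Sum>A | A \<in> K \<and> P A $ n \<noteq> 0. P A $ n)"
      unfolding L_def using sub fin K'K[of n] 
      by (simp, intro sum.mono_neutral_right) auto
  qed
  hence "((\<lambda>is. P (set is)) has_sum L) (increasing_tuples k)"
    using has_sum_reindex_bij_betw[OF bij_betw_set_increasing_tuples[of k], of P L]
    by (simp add: K_def)
  hence L: "(G has_sum L) (increasing_tuples k)"
    by (subst (asm) has_sum_cong[where g = G])
       (auto simp: G_def P_def prod_increasing_tuple)
  thus "G summable_on increasing_tuples k"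
    by (auto simp: summable_on_def)
  assume "i \<le> n"
  have "K' i \<subseteq> K' n"
    using \<open>i \<le> n\<close> by (auto simp: K'_def)
  hence "(\<Sum>A\<in>K' i. P A $ i) = (\<Sum>A\<in>K' n. P A $ i)"
    using fin[of n] K'K[of n] P0[of _ i] by (intro sum.mono_neutral_left) blast+
  thus "(\<Sum>\<^sub>\<infinity>is\<in>increasing_tuples k. G is) $ i
           = (\<Sum>A | A \<subseteq> {1..n} \<and> card A = k. \<Prod>j\<in>A. h j) $ i"
    using infsumI[OF L] by (simp add: L_def fps_sum_nth K'_def P_def)
qed

section \<open>Partitions with prescribed multiplicities\<close>

text \<open>
  For \<open>j > 0\<close> this is the series \<open>\<Sum>c\<in>M. x\<^bsup>j c\<^esup>\<close>, which records the choice of a multiplicity in \<open>M\<close> for the part \<open>j\<close>.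
\<close>

definition mult_gf :: "nat set \<Rightarrow> nat \<Rightarrow> 'a::semiring_1 fps"
  where "mult_gf M j = Abs_fps (\<lambda>n. if j dvd n \<and> n div j \<in> M then 1 else 0)"

definition restricted_partitions :: "nat set \<Rightarrow> (nat \<Rightarrow> nat set) \<Rightarrow> nat \<Rightarrow> nat multiset set"
  where "restricted_partitions J M n =
    {T. set_mset T \<subseteq> J \<and> sum_mset T = n \<and> (\<forall>j\<in>J. count T j \<in> M j)}"

lemma mult_gf_mult_nth:
  fixes P :: "'a::semiring_1 fps"
  assumes "j > 0"
  shows "(mult_gf M j * P) $ n = (\<Sum>c | c \<in> M \<and> j * c \<le> n. P $ (n - j * c))"
proof -
  have "(mult_gf M j * P) $ n = (\<Sum>i | i \<le> n \<and> j dvd i \<and> i div j \<in> M. P $ (n - i))"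
    unfolding fps_mult_nth
    by (intro sum.mono_neutral_cong_right) (auto simp: mult_gf_def)
  also have "\<dots> = (\<Sum>c | c \<in> M \<and> j * c \<le> n. P $ (n - j * c))"
    by (rule sum.reindex_bij_witness[of _ "\<lambda>c. j * c" "\<lambda>i. i div j"]) (use assms in auto)
  finally show ?thesis .
qed

text \<open>
  Splitting off all copies of the part \<open>a\<close>: this is the combinatorial side of the recursion that
  \<open>mult_gf_mult_nth\<close> expresses for coefficients.
\<close>

lemma bij_betw_restricted_partitions_insert:
  assumes "a \<notin> J"
  shows "bij_betw (\<lambda>T. (count T a, filter_mset (\<lambda>x. x \<noteq> a) T))
    (restricted_partitions (insert a J) M n)
    (SIGMA c:{c \<in> M a. a * c \<le> n}. restricted_partitions J M (n - a * c))"
proof (rule bij_betw_byWitness[where f' = "\<lambda>(c, T). T + replicate_mset c a"], goal_cases)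
  case 1
  have "filter_mset (\<lambda>x. x \<noteq> a) T + replicate_mset (count T a) a = T" for T
    by (rule multiset_eqI) auto
  thus ?case
    by auto
next
  case 2
  have "filter_mset (\<lambda>x. x \<noteq> a) (T + replicate_mset c a) = T \<and> count T a = 0"
    if "set_mset T \<subseteq> J" for T c
    using that assms by (auto simp: multiset_eq_iff count_eq_zero_iff)
  thus ?case
    by (auto simp: restricted_partitions_def)
next
  case 3
  have "sum_mset (filter_mset (\<lambda>x. x \<noteq> a) T) + a * count T a = sum_mset T" for T
  proof -
    have "T = filter_mset (\<lambda>x. x \<noteq> a) T + replicate_mset (count T a) a"
      by (rule multiset_eqI) auto
    from arg_cong[OF this, of sum_mset] show ?thesis
      by simp
  qed
  hence "sum_mset (filter_mset (\<lambda>x. x \<noteq> a) T) = sum_mset T - a * count T a"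
    "a * count T a \<le> sum_mset T" for T
    by (metis add_diff_cancel_right', metis le_add2)
  thus ?case
    using assms by (auto simp: restricted_partitions_def)
next
  case 4
  have "count T a = 0" if "set_mset T \<subseteq> J" for T
    using that assms by (auto simp: count_eq_zero_iff)
  thus ?case
    using assms by (auto simp: restricted_partitions_def split: if_splits)
qed

lemma card_restricted_partitions:
  assumes "finite J" "0 \<notin> J"
  shows "finite (restricted_partitions J M n)"
    and "(\<Prod>j\<in>J. mult_gf (M j) j) $ n = (of_nat (card (restricted_partitions J M n)) :: 'a::comm_semiring_1)"
proof -
  have "finite (restricted_partitions J M n) \<and>
    (\<Prod>j\<in>J. mult_gf (M j) j) $ n = (of_nat (card (restricted_partitions J M n)) :: 'a)"
    using assms
  proof (induction J arbitrary: n rule: finite_induct)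
    case empty
    have "restricted_partitions {} M n = (if n = 0 then {{#}} else {})"
      by (auto simp: restricted_partitions_def)
    thus ?case
      by simp
  next
    case (insert a J)
    let ?C = "{c \<in> M a. a * c \<le> n}"
    have a: "a > 0"
      using insert.prems by auto
    have "finite ?C"
      by (rule finite_subset[of _ "{..n}"]) (use a in \<open>auto intro: order_trans[rotated]\<close>)
    note bij = bij_betw_restricted_partitions_insert[OF insert.hyps(2), of M n]
    have IH: "finite (restricted_partitions J M i)"
      "(\<Prod>j\<in>J. mult_gf (M j) j) $ i = (of_nat (card (restricted_partitions J M i)) :: 'a)" for i
      using insert.IH[of i] insert.prems by auto
    have "card (restricted_partitions (insert a J) M n)
            = (\<Sum>c\<in>?C. card (restricted_partitions J M (n - a * c)))"
      using bij_betw_same_card[OF bij] \<open>finite ?C\<close> IH(1) by simp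
    moreover have "finite (restricted_partitions (insert a J) M n)"
      using bij_betw_finite[OF bij] \<open>finite ?C\<close> IH(1) by blast
    ultimately show ?case
      using insert.hyps by (simp add: mult_gf_mult_nth[OF a] IH(2))
  qed
  thus "finite (restricted_partitions J M n)"
    "(\<Prod>j\<in>J. mult_gf (M j) j) $ n = (of_nat (card (restricted_partitions J M n)) :: 'a)"
    by (fact conjunct1, fact conjunct2)
qed

lemma mult_gf_singleton:
  assumes "j > 0"
  shows "mult_gf {c} j = fps_X ^ (j * c)"
  using assms by (auto simp: fps_eq_iff mult_gf_def)

lemma mult_gf_UNIV:
  assumes "j > 0"
  shows "mult_gf UNIV j * (1 - fps_X ^ j) = (1 :: 'a::comm_ring_1 fps)"
proof (rule fps_ext)
  fix n
  show "(mult_gf UNIV j * (1 - fps_X ^ j)) $ n = (1 :: 'a fps) $ n"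
    using assms by (auto simp: right_diff_distrib fps_X_power_mult_right_nth mult_gf_def
        dvd_minus_self dest: dvd_imp_le)
qed

lemma mult_gf_Compl:
  "mult_gf (- M) j = mult_gf UNIV j - (mult_gf M j :: 'a::ring_1 fps)"
  by (auto simp: fps_eq_iff mult_gf_def)

section \<open>Tests with a prescribed set of valid answers\<close>

definition validity_mults :: "nat set \<Rightarrow> nat \<Rightarrow> nat set"
  where "validity_mults A j = (if j \<in> A then {j} else - {j})"

lemma le_sum_mset:
  "(a :: nat) \<in># T \<Longrightarrow> a \<le> sum_mset T"
  by (auto dest: multi_member_split)

lemma set_mset_natural_test:
  "natural_test T \<Longrightarrow> set_mset T \<subseteq> {1..cost T}"
  unfolding natural_test_def cost_def using le_sum_mset
  by (intro subsetI) (simp add: Suc_le_eq)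

lemma valid_answer_imp_mem:
  "valid_answer T a \<Longrightarrow> a \<in># T"
  by (metis count_greater_zero_iff valid_answer_def)

text \<open>
  Restricting the parts to \<open>{1..n}\<close> loses nothing, because a test of cost \<open>n\<close> has no larger answer;
  in particular numbers above \<open>n\<close> are never valid.
\<close>

lemma restricted_partitions_validity_mults:
  assumes "A \<subseteq> {1..n}"
  shows "restricted_partitions {1..n} (validity_mults A) n =
    {T. natural_test T \<and> cost T = n \<and> {a. valid_answer T a} = A}"
proof -
  have "(\<forall>j\<in>{1..n}. count T j \<in> validity_mults A j) \<longleftrightarrow> {a. valid_answer T a} = A"
    if T: "set_mset T \<subseteq> {1..n}" for T
  proof -
    have "(\<forall>j\<in>{1..n}. count T j \<in> validity_mults A j)
        \<longleftrightarrow> (\<forall>j\<in>{1..n}. valid_answer T j \<longleftrightarrow> j \<in> A)"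
      by (intro ball_cong refl) (auto simp: validity_mults_def valid_answer_def)
    also have "\<dots> \<longleftrightarrow> {a. valid_answer T a} = A"
      using assms T valid_answer_imp_mem[of T] by blast
    finally show ?thesis .
  qed
  moreover have "natural_test T \<and> cost T = n \<longleftrightarrow> set_mset T \<subseteq> {1..n} \<and> sum_mset T = n" for T
    using set_mset_natural_test[of T] by (auto simp: natural_test_def cost_def)
  ultimately show ?thesis
    unfolding restricted_partitions_def by blast
qed

lemma num_tests_eq_sum:
  "num_tests n k = (\<Sum>A | A \<subseteq> {1..n} \<and> card A = k.
     card (restricted_partitions {1..n} (validity_mults A) n))"
proof -
  let ?K = "{A. A \<subseteq> {1..n} \<and> card A = k}"
  let ?R = "\<lambda>A. restricted_partitions {1..n} (validity_mults A) n"
  have fin: "finite ?K"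
    by (rule finite_subset[of _ "Pow {1..n}"]) auto
  have "{a. valid_answer T a} \<subseteq> {1..n}" if "natural_test T" "cost T = n" for T
    using set_mset_natural_test[of T] valid_answer_imp_mem[of T] that by blast
  hence "{T. natural_test T \<and> cost T = n \<and> card {a. valid_answer T a} = k} = (\<Union>A\<in>?K. ?R A)"
    by (auto simp: restricted_partitions_validity_mults simp del: One_nat_def)
  moreover have "card (\<Union>A\<in>?K. ?R A) = (\<Sum>A\<in>?K. card (?R A))"
  proof (rule card_UN_disjoint[OF fin])
    show "\<forall>A\<in>?K. finite (?R A)"
      using card_restricted_partitions(1) by auto
    show "\<forall>A\<in>?K. \<forall>B\<in>?K. A \<noteq> B \<longrightarrow> ?R A \<inter> ?R B = {}"
      by (auto simp: restricted_partitions_validity_mults simp del: One_nat_def)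
  qed
  ultimately show ?thesis
    by (simp add: num_tests_def)
qed

section \<open>Comparison of the factors of valid and invalid answers\<close>

definition invalid_gf :: "nat \<Rightarrow> 'a::field fps"
  where "invalid_gf j = 1 / (1 - fps_X ^ j) - fps_X ^ j\<^sup>2"

definition valid_ratio :: "nat \<Rightarrow> 'a::field fps"
  where "valid_ratio j = fps_X ^ j\<^sup>2 * (1 - fps_X ^ j) / (1 - fps_X ^ j\<^sup>2 + fps_X ^ (j\<^sup>2 + j))"

lemma one_over_one_minus_X_power:
  assumes "j > 0"
  shows "1 / (1 - fps_X ^ j) = (mult_gf UNIV j :: 'a::field fps)"
proof -
  have "1 / (1 - fps_X ^ j) = inverse (1 - fps_X ^ j :: 'a fps)"
    using assms by (subst fps_divide_unit) auto
  also have "\<dots> = mult_gf UNIV j"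
    using assms mult_gf_UNIV[OF assms, where ?'a = 'a] 
    by (intro fps_inverse_unique) (simp add: mult.commute)
  finally show ?thesis .
qed

lemma mult_gf_invalid:
  assumes "j > 0"
  shows "mult_gf (- {j}) j = (invalid_gf j :: 'a::field fps)"
  using assms
  by (simp add: invalid_gf_def mult_gf_Compl one_over_one_minus_X_power mult_gf_singleton
      power2_eq_square)

lemma valid_ratio_unit:
  fixes j :: nat
  defines "D \<equiv> 1 - fps_X ^ j\<^sup>2 + fps_X ^ (j\<^sup>2 + j) :: 'a::field fps"
  assumes "j > 0"
  shows "valid_ratio j = fps_X ^ j\<^sup>2 * (1 - fps_X ^ j) * inverse D" "D $ 0 \<noteq> 0"
proof -
  show "D $ 0 \<noteq> 0"
    using assms by (simp add: D_def)
  thus "valid_ratio j = fps_X ^ j\<^sup>2 * (1 - fps_X ^ j) * inverse D"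
    unfolding valid_ratio_def by (simp add: fps_divide_unit D_def)
qed

text \<open>
  The denominator of \<open>valid_ratio\<close> is \<open>invalid_gf j * (1 - x\<^sup>j)\<close>, so that \<open>valid_ratio j\<close> is the quotient
  of the generating function for the multiplicity \<open>j\<close> by the one for all other multiplicities.
\<close>

lemma invalid_gf_mult_valid_ratio:
  assumes "j > 0"
  shows "invalid_gf j * valid_ratio j = (mult_gf {j} j :: 'a::field fps)"
proof -
  let ?D = "1 - fps_X ^ j\<^sup>2 + fps_X ^ (j\<^sup>2 + j) :: 'a fps"
  have "invalid_gf j * (1 - fps_X ^ j)
      = mult_gf UNIV j * (1 - fps_X ^ j) - fps_X ^ j\<^sup>2 * (1 - fps_X ^ j :: 'a fps)"
    unfolding invalid_gf_def one_over_one_minus_X_power[OF assms] by (rule left_diff_distrib)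
  also have "\<dots> = ?D"
    unfolding mult_gf_UNIV[OF assms] by (simp add: algebra_simps power_add)
  finally have D: "invalid_gf j * (1 - fps_X ^ j) = ?D" .
  have "invalid_gf j * valid_ratio j
      = fps_X ^ j\<^sup>2 * (invalid_gf j * (1 - fps_X ^ j)) * inverse ?D"
    unfolding valid_ratio_unit(1)[OF assms] by (simp only: mult_ac)
  also have "\<dots> = fps_X ^ j\<^sup>2 * (?D * inverse ?D)"
    unfolding D by (simp only: mult_ac)
  also have "\<dots> = fps_X ^ j\<^sup>2"
    using valid_ratio_unit(2)[OF assms, where ?'a = 'a] inverse_mult_eq_1'[of ?D] by simp
  finally show ?thesis
    using assms by (simp add: mult_gf_singleton power2_eq_square)
qed

lemma prod_mult_gf_validity_mults:
  assumes "A \<subseteq> {1..n}"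
  shows "(\<Prod>j\<in>{1..n}. mult_gf (validity_mults A j) j)
    = (\<Prod>j\<in>{1..n}. invalid_gf j) * (\<Prod>j\<in>A. valid_ratio j :: 'a::field fps)"
proof -
  have "(\<Prod>j\<in>{1..n}. mult_gf (validity_mults A j) j)
      = (\<Prod>j\<in>{1..n}. invalid_gf j * (if j \<in> A then valid_ratio j else 1 :: 'a fps))"
    by (intro prod.cong)
       (auto simp: validity_mults_def invalid_gf_mult_valid_ratio mult_gf_invalid)
  also have "\<dots> = (\<Prod>j\<in>{1..n}. invalid_gf j) * (\<Prod>j\<in>{1..n} \<inter> A. valid_ratio j)"
    by (simp add: prod.distrib prod.inter_restrict)
  also have "{1..n} \<inter> A = A"
    using assms by auto
  finally show ?thesis .
qed

text \<open>The finite form of the theorem: the parts are bounded by the degree of the coefficient.\<close>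

lemma num_tests_eq_nth:
  "of_nat (num_tests n k) = ((\<Prod>j<n. invalid_gf (Suc j)) *
     (\<Sum>A | A \<subseteq> {1..n} \<and> card A = k. \<Prod>j\<in>A. valid_ratio j) :: 'a::field fps) $ n"
proof -
  let ?K = "{A. A \<subseteq> {1..n} \<and> card A = k}"
  have "of_nat (num_tests n k)
      = (\<Sum>A\<in>?K. (\<Prod>j\<in>{1..n}. mult_gf (validity_mults A j) j :: 'a fps) $ n)"
    unfolding num_tests_eq_sum by (simp add: card_restricted_partitions(2))
  also have "\<dots> = (\<Sum>A\<in>?K. ((\<Prod>j\<in>{1..n}. invalid_gf j) * (\<Prod>j\<in>A. valid_ratio j)) $ n)"
    by (intro sum.cong refl) (simp only: mem_Collect_eq prod_mult_gf_validity_mults)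
  also have "\<dots> = ((\<Prod>j\<in>{1..n}. invalid_gf j) * (\<Sum>A\<in>?K. \<Prod>j\<in>A. valid_ratio j)) $ n"
    by (simp add: fps_sum_nth sum_distrib_left)
  also have "(\<Prod>j\<in>{1..n}. invalid_gf j) = (\<Prod>j<n. invalid_gf (Suc j) :: 'a fps)"
    by (simp add: prod.atLeast1_atMost_eq)
  finally show ?thesis .
qed

section \<open>Passage to the infinite product and sum\<close>

text \<open>
  The part \<open>j + 1\<close> either does not occur or costs at least \<open>j + 1\<close>; and the correction
  \<open>x\<^bsup>(j+1)\<^sup>2\<^esup>\<close> does not affect lower degrees.
\<close>

lemma X_power_dvd_invalid_gf:
  "fps_X ^ Suc j dvd (invalid_gf (Suc j) :: 'a::field fps) - 1"
proof -
  let ?U = "mult_gf UNIV (Suc j) :: 'a fps"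
  have "invalid_gf (Suc j) - 1 = ?U - fps_X ^ (Suc j)\<^sup>2 - ?U * (1 - fps_X ^ Suc j)"
    by (simp only: invalid_gf_def one_over_one_minus_X_power mult_gf_UNIV zero_less_Suc)
  also have "\<dots> = fps_X ^ Suc j * ?U - fps_X ^ (Suc j)\<^sup>2"
    by (simp only: algebra_simps) simp
  finally have "invalid_gf (Suc j) - 1 = fps_X ^ Suc j * ?U - fps_X ^ (Suc j)\<^sup>2" .
  thus ?thesis
    by (simp only:) (intro dvd_diff dvd_triv_left le_imp_power_dvd, simp add: power2_eq_square)
qed

lemma X_power_dvd_valid_ratio:
  "fps_X ^ j dvd (valid_ratio j :: 'a::field fps)"
proof (cases "j = 0")
  case False
  thus ?thesis
    unfolding valid_ratio_unit(1)[OF False[unfolded neq0_conv]]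
    by (intro dvd_mult2 le_imp_power_dvd) (simp add: power2_eq_square)
qed simp

theorem corollary4:
  fixes k :: nat
  defines "F \<equiv> (\<lambda>j. 1 / (1 - fps_X ^ Suc j) - fps_X ^ (Suc j)\<^sup>2 :: rat fps)"
    and "G \<equiv> (\<lambda>is. \<Prod>r<k. fps_X ^ (is ! r)\<^sup>2 * (1 - fps_X ^ (is ! r))
                 / (1 - fps_X ^ (is ! r)\<^sup>2 + fps_X ^ ((is ! r)\<^sup>2 + is ! r)) :: rat fps)"
  shows "convergent_prod F \<and> G summable_on increasing_tuples k \<and>
         tests_gf k = (\<Prod>j. F j) * (\<Sum>\<^sub>\<infinity>is\<in>increasing_tuples k. G is)"
proof -
  have F: "F = (\<lambda>j. invalid_gf (Suc j))"
    by (simp add: F_def invalid_gf_def)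
  have G: "G = (\<lambda>is. \<Prod>r<k. valid_ratio (is ! r))"
    by (simp add: G_def valid_ratio_def)
  note prod_F = fps_convergent_prod[of F, unfolded F, OF X_power_dvd_invalid_gf, folded F]
  have summable_G: "G summable_on increasing_tuples k"
    unfolding G by (intro infsum_increasing_tuples(1) X_power_dvd_valid_ratio)
  have sum_G: "(\<Sum>A | A \<subseteq> {1..n} \<and> card A = k. \<Prod>j\<in>A. valid_ratio j) $ i
      = (\<Sum>\<^sub>\<infinity>is\<in>increasing_tuples k. G is) $ i" if "i \<le> n" for i n
    unfolding G by (intro infsum_increasing_tuples(2)[symmetric] X_power_dvd_valid_ratio that)
  have "tests_gf k $ n = ((\<Prod>j. F j) * (\<Sum>\<^sub>\<infinity>is\<in>increasing_tuples k. G is)) $ n" for n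
  proof -
    have "tests_gf k $ n = ((\<Prod>j<n. F j) *
        (\<Sum>A | A \<subseteq> {1..n} \<and> card A = k. \<Prod>j\<in>A. valid_ratio j)) $ n"
      by (simp add: tests_gf_def num_tests_eq_nth F)
    also have "\<dots> = ((\<Prod>j. F j) * (\<Sum>\<^sub>\<infinity>is\<in>increasing_tuples k. G is)) $ n"
      by (intro fps_mult_nth_cong prod_F(2)[symmetric] sum_G)
    finally show ?thesis .
  qed
  thus ?thesis
    using prod_F(1) summable_G by (auto intro: fps_ext)
qed

end
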